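(* Let $n$ be a positive integer, let $\mathcal B\subseteq\mathcal P([n])$ be a simply rooted family with $|\mathcal B|=m$, and let $p\in[0,1]$. Suppose that no $i\in[n]$ has $|\mathcal B_{\{i\}}|\ge pm$. Then \[ \|\mathcal B\|\le \|\mathcal I(m)\|+m-\frac{m^2(1/8-p^2/8)}{2^n}. \]
   Context: A family $\mathcal B\subseteq\mathcal P([n])$ is simply rooted if for every nonempty $B\in\mathcal B$ there is $b\in B$ with $[\{b\},B]:=\{C:\{b\}\subseteq C\subseteq B\}\subseteq\mathcal B$. $B\in\mathcal B$ is $\mathcal B$-rooted at $i$ if $i\in B$ and $[\{i\},B]\subseteq\mathcal B$; for $S\subseteq[n]$, $\mathcal B_S$ is the family of sets of $\mathcal B$ that are $\mathcal B$-rooted at some $i\in S$. $\|\mathcal F\|=\sum_{F\in\mathcal F}|F|$. The colex order on finite sets of positive integers: $A<B$ iff $\max(A\triangle B)\in B$; $\mathcal I(m)$ is the family of the first $m$ sets in this order. *)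

theory Defs
  imports Complex_Main
begin

text \<open>The ground set [n] is \<open>{1..n}\<close>, and the interval [{b}, B] in the inclusion order is the
  library interval \<open>{{b}..B}\<close>.\<close>

definition simply_rooted :: "nat set set \<Rightarrow> bool" where
  "simply_rooted \<B> \<longleftrightarrow> (\<forall>B\<in>\<B>. B \<noteq> {} \<longrightarrow> (\<exists>b\<in>B. {{b}..B} \<subseteq> \<B>))"

definition rooted_at :: "nat set set \<Rightarrow> nat \<Rightarrow> nat set \<Rightarrow> bool" where
  "rooted_at \<B> i B \<longleftrightarrow> i \<in> B \<and> {{i}..B} \<subseteq> \<B>"

definition rooted_part :: "nat set set \<Rightarrow> nat set \<Rightarrow> nat set set" where
  "rooted_part \<B> S = {B \<in> \<B>. \<exists>i\<in>S. rooted_at \<B> i B}"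

definition total_size :: "nat set set \<Rightarrow> nat" where
  "total_size \<F> = (\<Sum>F\<in>\<F>. card F)"

definition finite_pos_sets :: "nat set set" where
  "finite_pos_sets = {A. finite A \<and> 0 \<notin> A}"

text \<open>The condition \<open>A \<noteq> B\<close> excludes the unspecified value \<open>Max {}\<close>.\<close>

definition colex_less :: "nat set \<Rightarrow> nat set \<Rightarrow> bool" where
  "colex_less A B \<longleftrightarrow> A \<noteq> B \<and> Max ((A - B) \<union> (B - A)) \<in> B"

text \<open>The first m sets are those with fewer than m predecessors. Every set has only finitely many
  predecessors, so \<open>card\<close> is meaningful here.\<close>

definition colex_initial :: "nat \<Rightarrow> nat set set" where
  "colex_initial m =
     {A \<in> finite_pos_sets. card {B \<in> finite_pos_sets. colex_less B A} < m}"

lemma finite_colex_predecessors: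
  assumes "A \<in> finite_pos_sets"
  shows "finite {B \<in> finite_pos_sets. colex_less B A}"
proof (rule finite_subset)
  show "{B \<in> finite_pos_sets. colex_less B A} \<subseteq> Pow {..Max A}"
  proof (intro subsetI PowI)
    fix B x assume "B \<in> {B \<in> finite_pos_sets. colex_less B A}" and x: "x \<in> B"
    then have B: "B \<in> finite_pos_sets" "colex_less B A" by auto
    have fin: "finite A" "finite B" using assms B by (auto simp: finite_pos_sets_def)
    let ?M = "Max ((B - A) \<union> (A - B))"
    have "?M \<in> A" using B by (simp add: colex_less_def)
    show "x \<in> {..Max A}"
    proof (cases "x \<in> A")
      case True
      then show ?thesis using fin by simp
    next
      case False
      then have "x \<le> ?M" using x fin by (intro Max_ge) auto
      also have "?M \<le> Max A" using fin \<open>?M \<in> A\<close> by simp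
      finally show ?thesis by simp
    qed
  qed
qed simp

end

(*
  Split [n] into S and T, and let X and Y be the families of sets of B rooted in S and in T.
  Down-compress B at every point of S and then at every point of T. A set loses a point only if it
  is rooted there, and the set it becomes is never moved again. Since Y is closed under removing
  points of S, the sets of Y survive the first stage, so that stage removes at most |B| - |Y|
  points. Let X* and Y* be the down-closed families obtained by compressing X along S and Y along
  T. Before the second stage X* is already contained in the family, and every set created in that
  stage lies in Y*, so it removes at most |Y* - X*| = |Y| - |X* \<inter> Y*| points. The final family is
  down-closed, so its total size is at most that of I(m), and therefore
    ||B|| <= ||I(m)|| + m - |X* \<inter> Y*| <= ||I(m)|| + m - |X| |Y| / 2^n
  by the Harris-Kleitman inequality. As no B_{i} has pm sets, adding points to S one at a time
  makes |X| lie between (1-p)m/2 and (1+p)m/2, and then |X| |Y| >= (1-p^2) m^2 / 4.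
*)

theory Submission
  imports Defs "HOL-Library.Nat_Bijection"
begin

section \<open>Families of sets split at a point\<close>

definition deletion :: "'a \<Rightarrow> 'a set set \<Rightarrow> 'a set set" where
  "deletion x F = {A \<in> F. x \<notin> A}"

definition link :: "'a \<Rightarrow> 'a set set \<Rightarrow> 'a set set" where
  "link x F = {A. x \<notin> A \<and> insert x A \<in> F}"

definition down_closed :: "'a set set \<Rightarrow> bool" where
  "down_closed F \<longleftrightarrow> (\<forall>A\<in>F. Pow A \<subseteq> F)"

definition down_at :: "'a \<Rightarrow> 'a set set \<Rightarrow> bool" where
  "down_at x F \<longleftrightarrow> (\<forall>A\<in>F. A - {x} \<in> F)"

lemma family_split: "F = deletion x F \<union> insert x ` link x F"
proof (intro equalityI subsetI)
  fix A assume "A \<in> F"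
  then show "A \<in> deletion x F \<union> insert x ` link x F"
    by (cases "x \<in> A")
      (auto simp: deletion_def link_def insert_absorb intro!: image_eqI[of _ _ "A - {x}"])
qed (auto simp: deletion_def link_def)

lemma deletion_link_disjoint: "deletion x F \<inter> insert x ` link x F = {}"
  by (auto simp: deletion_def)

lemma inj_on_insert_notin: "(\<And>A. A \<in> F \<Longrightarrow> x \<notin> A) \<Longrightarrow> inj_on (insert x) F"
  by (rule inj_onI) (simp add: insert_ident)

lemma inj_on_insert_link: "inj_on (insert x) (link x F)"
  by (rule inj_on_insert_notin) (auto simp: link_def)

lemma finite_deletion [simp]: "finite F \<Longrightarrow> finite (deletion x F)"
  by (simp add: deletion_def)

lemma finite_link [simp]: "finite F \<Longrightarrow> finite (link x F)"
  by (rule inj_on_finite[OF inj_on_insert_link]) (auto simp: link_def)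

lemma card_split:
  assumes "finite F"
  shows "card F = card (deletion x F) + card (link x F)"
  by (subst family_split[of F x])
    (simp add: card_Un_disjoint card_image inj_on_insert_link deletion_link_disjoint assms)

lemma total_size_insert_image:
  assumes "finite N" "\<And>A. A \<in> N \<Longrightarrow> finite A \<and> x \<notin> A"
  shows "total_size (insert x ` N) = total_size N + card N"
proof -
  have "total_size (insert x ` N) = (\<Sum>A\<in>N. card (insert x A))"
    unfolding total_size_def using assms(2) by (subst sum.reindex[OF inj_on_insert_notin]) auto
  also have "\<dots> = (\<Sum>A\<in>N. card A + 1)"
    using assms(2) by (intro sum.cong) auto
  finally show ?thesis by (simp add: total_size_def sum_Suc)
qed

lemma total_size_split:
  assumes "finite F" "\<And>A. A \<in> F \<Longrightarrow> finite A"
  shows "total_size F = total_size (deletion x F) + total_size (link x F) + card (link x F)"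
proof -
  have "total_size F = total_size (deletion x F) + total_size (insert x ` link x F)"
    unfolding total_size_def
    by (subst (1) family_split[of F x])
      (simp add: sum.union_disjoint deletion_link_disjoint assms)
  also have "total_size (insert x ` link x F) = total_size (link x F) + card (link x F)"
  proof (rule total_size_insert_image)
    show "finite A \<and> x \<notin> A" if "A \<in> link x F" for A
      using that assms(2)[of "insert x A"] by (simp add: link_def)
  qed (simp add: assms)
  finally show ?thesis by simp
qed

lemma deletion_subset_Pow: "F \<subseteq> Pow (insert x V) \<Longrightarrow> deletion x F \<subseteq> Pow V"
  by (auto simp: deletion_def)

lemma link_subset_Pow: "F \<subseteq> Pow (insert x V) \<Longrightarrow> link x F \<subseteq> Pow V"
  by (auto simp: link_def)

lemma down_closed_deletion: "down_closed F \<Longrightarrow> down_closed (deletion x F)"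
  unfolding down_closed_def deletion_def by blast

lemma down_closed_link: "down_closed F \<Longrightarrow> down_closed (link x F)"
  unfolding down_closed_def link_def by (auto dest!: bspec dest: insert_mono)

lemma link_subset_deletion: "down_closed F \<Longrightarrow> link x F \<subseteq> deletion x F"
  unfolding down_closed_def link_def deletion_def by blast

lemma down_closedI:
  assumes "F \<subseteq> Pow V" "finite V" "\<And>x. x \<in> V \<Longrightarrow> down_at x F"
  shows "down_closed F"
proof -
  have "A - C \<in> F" if "A \<in> F" "finite C" "C \<subseteq> V" for A C
    using that(2,3)
  proof (induction C)
    case (insert x C)
    then have "(A - C) - {x} \<in> F" using assms(3) unfolding down_at_def by auto
    then show ?case by (metis Diff_insert)
  qed (use that in auto)
  then have "C \<in> F" if "A \<in> F" "C \<subseteq> A" for A C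
    using that assms(1,2) by (metis Diff_subset PowD double_diff finite_subset subset_iff)
  then show ?thesis unfolding down_closed_def by blast
qed

section \<open>The Harris--Kleitman inequality\<close>

lemma card_down_closed_Int:
  assumes "finite V" "F \<subseteq> Pow V" "G \<subseteq> Pow V" "down_closed F" "down_closed G"
  shows "card F * card G \<le> 2 ^ card V * card (F \<inter> G)"
  using assms
proof (induction V arbitrary: F G)
  case empty
  then have "F = {} \<or> F = {{}}" "G = {} \<or> G = {{}}" by auto
  then show ?case by auto
next
  case (insert x V)
  have fin: "finite F" "finite G" using insert.prems insert.hyps by (auto intro: finite_subset)
  let ?a = "card (deletion x F)" and ?b = "card (link x F)"
    and ?c = "card (deletion x G)" and ?d = "card (link x G)"
  have le: "?b \<le> ?a" "?d \<le> ?c"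
    using insert.prems fin by (auto intro!: card_mono link_subset_deletion)
  have "?a * ?c \<le> 2 ^ card V * card (deletion x F \<inter> deletion x G)"
    using insert.prems
    by (intro insert.IH deletion_subset_Pow down_closed_deletion) simp_all
  moreover have "?b * ?d \<le> 2 ^ card V * card (link x F \<inter> link x G)"
    using insert.prems
    by (intro insert.IH link_subset_Pow down_closed_link) simp_all
  moreover have "deletion x F \<inter> deletion x G = deletion x (F \<inter> G)"
    "link x F \<inter> link x G = link x (F \<inter> G)"
    by (auto simp: deletion_def link_def)
  moreover have "card (F \<inter> G) = card (deletion x (F \<inter> G)) + card (link x (F \<inter> G))"
    using fin by (intro card_split) simp
  ultimately have IH: "?a * ?c + ?b * ?d \<le> 2 ^ card V * card (F \<inter> G)"
    by (simp only: distrib_left)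
  \<comment> \<open>Writing the surpluses as \<open>i\<close> and \<open>j\<close> avoids
    subtraction: the next inequality holds because the right side exceeds the left by (a - b) * (c -
    d) = \<open>i * j\<close>. Closure downwards gives both differences the same sign.\<close>
  obtain i j where ij: "?a = ?b + i" "?c = ?d + j"
    using le by (meson le_Suc_ex)
  have "(?a + ?b) * (?c + ?d) \<le> 2 * (?a * ?c + ?b * ?d)"
    unfolding ij by (simp add: algebra_simps)
  also have "\<dots> \<le> 2 ^ card (insert x V) * card (F \<inter> G)"
    using IH insert.hyps by simp
  finally show ?case
    unfolding card_split[OF fin(1), of x] card_split[OF fin(2), of x] .
qed

section \<open>Down-closed families are no larger than colex segments\<close>

text \<open>The number of ones in the binary expansions of 0, ..., m - 1. It will be the total size
  of I(m), because colex compares characteristic vectors as binary numbers.\<close>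

definition binary_weight :: "nat \<Rightarrow> nat" where
  "binary_weight m = (\<Sum>i<m. card (set_decode i))"

lemma set_decode_double: "set_decode (2 * k) = Suc ` set_decode k"
proof (rule set_eqI)
  fix i show "i \<in> set_decode (2 * k) \<longleftrightarrow> i \<in> Suc ` set_decode k"
    by (cases i) (auto simp: set_decode_Suc)
qed

lemma set_decode_double_Suc: "set_decode (Suc (2 * k)) = insert 0 (Suc ` set_decode k)"
proof (rule set_eqI)
  fix i show "i \<in> set_decode (Suc (2 * k)) \<longleftrightarrow> i \<in> insert 0 (Suc ` set_decode k)"
    by (cases i) (auto simp: set_decode_Suc)
qed

lemma card_set_decode_double:
  "card (set_decode (2 * k)) = card (set_decode k)"
  "card (set_decode (Suc (2 * k))) = Suc (card (set_decode k))"
  by (simp_all add: set_decode_double set_decode_double_Suc card_image)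

text \<open>The numbers below 2k form pairs 2j, 2j + 1 with j < k. Both inherit the ones of j, and
  the odd number has one more.\<close>

lemma binary_weight_double: "binary_weight (2 * k) = 2 * binary_weight k + k"
  by (induction k) (auto simp: binary_weight_def card_set_decode_double)

lemma binary_weight_double_Suc:
  "binary_weight (Suc (2 * k)) = binary_weight k + binary_weight (Suc k) + k"
  using binary_weight_double[of k] by (simp add: binary_weight_def card_set_decode_double)

text \<open>Strong induction on \<open>a + b\<close>: halving both numbers according to parity turns
  the claim into a sum of two smaller instances. This is the arithmetic behind gluing a link of size
  \<open>b\<close> onto a deletion of size \<open>a\<close>.\<close>

lemma binary_weight_superadditive:
  "b \<le> a \<Longrightarrow> binary_weight a + binary_weight b + b \<le> binary_weight (a + b)"
proof (induction "a + b" arbitrary: a b rule: less_induct)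
  case less
  show ?case
  proof (cases "b = 0")
    case True
    then show ?thesis by (simp add: binary_weight_def)
  next
    case False
    define c d where "c = a div 2" and "d = b div 2"
    then have "a = 2 * c \<or> a = Suc (2 * c)" "b = 2 * d \<or> b = Suc (2 * d)" by presburger+
    then consider (ee) "a = 2 * c" "b = 2 * d" | (oe) "a = Suc (2 * c)" "b = 2 * d"
      | (eo) "a = 2 * c" "b = Suc (2 * d)" | (oo) "a = Suc (2 * c)" "b = Suc (2 * d)"
      by blast
    then show ?thesis
    proof cases
      case ee
      have "binary_weight c + binary_weight d + d \<le> binary_weight (c + d)"
        using ee less.prems False by (intro less.hyps) auto
      moreover have "a + b = 2 * (c + d)" using ee by simp
      ultimately show ?thesis
        using ee by (simp only: binary_weight_double; simp)
    next
      case oe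
      have "binary_weight c + binary_weight d + d \<le> binary_weight (c + d)"
        using oe less.prems False by (intro less.hyps) simp_all
      moreover have "binary_weight (Suc c) + binary_weight d + d \<le> binary_weight (Suc c + d)"
        using oe less.prems False by (intro less.hyps) simp_all
      moreover have "a + b = Suc (2 * (c + d))" using oe by simp
      ultimately show ?thesis
        using oe by (simp only: binary_weight_double binary_weight_double_Suc; simp)
    next
      case eo
      have "binary_weight c + binary_weight d + d \<le> binary_weight (c + d)"
        using eo less.prems False by (intro less.hyps) simp_all
      moreover have "binary_weight c + binary_weight (Suc d) + Suc d \<le> binary_weight (c + Suc d)"
        using eo less.prems False by (intro less.hyps) simp_all
      moreover have "a + b = Suc (2 * (c + d))" using eo by simp
      ultimately show ?thesis
        using eo by (simp only: binary_weight_double binary_weight_double_Suc; simp)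
    next
      case oo
      have 1: "binary_weight (Suc c) + binary_weight d + d \<le> binary_weight (Suc c + d)"
        using oo less.prems by (intro less.hyps) simp_all
      \<comment> \<open>Only \<open>+ d\<close> is required here, not \<open>+ Suc d\<close>. For
        \<open>c = d\<close> the pair \<open>c\<close>, \<open>Suc d\<close> is in the wrong order
        for the induction hypothesis, but then the claim is fact 1 with its summands
        swapped.\<close>
      have 2: "binary_weight c + binary_weight (Suc d) + d \<le> binary_weight (c + Suc d)"
      proof (cases "c = d")
        case True
        then show ?thesis using 1 by simp
      next
        case False
        then have "binary_weight c + binary_weight (Suc d) + Suc d \<le> binary_weight (c + Suc d)"
          using oo less.prems by (intro less.hyps) simp_all
        then show ?thesis by simp
      qed
      have "a + b = 2 * Suc (c + d)" using oo by simp
      then show ?thesis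
        using oo 1 2 by (simp only: binary_weight_double binary_weight_double_Suc; simp)
    qed
  qed
qed

text \<open>Splitting at \<open>x\<close> costs one extra point per member of the link. The link
  lies inside the deletion, so it is the smaller part and superadditivity absorbs exactly this
  cost.\<close>

lemma total_size_down_closed_le:
  assumes "finite V" "F \<subseteq> Pow V" "down_closed F"
  shows "total_size F \<le> binary_weight (card F)"
  using assms
proof (induction V arbitrary: F)
  case empty
  then have "F = {} \<or> F = {{}}" by auto
  then show ?case by (auto simp: total_size_def)
next
  case (insert x V)
  have fin: "finite F" using insert.prems insert.hyps by (auto intro: finite_subset)
  have "finite A" if "A \<in> F" for A
    using that insert.prems(1) insert.hyps(1) by (meson PowD finite.insertI finite_subset subsetD)
  then have "total_size F = total_size (deletion x F) + total_size (link x F) + card (link x F)"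
    by (rule total_size_split[OF fin])
  also have "\<dots> \<le> binary_weight (card (deletion x F)) + binary_weight (card (link x F))
      + card (link x F)"
    using insert.prems
    by (intro add_mono insert.IH deletion_subset_Pow link_subset_Pow down_closed_deletion
        down_closed_link) simp_all
  also have "\<dots> \<le> binary_weight (card (deletion x F) + card (link x F))"
    using insert.prems fin
    by (intro binary_weight_superadditive card_mono link_subset_deletion) simp_all
  finally show ?case by (simp add: card_split[OF fin, of x])
qed

section \<open>Colex order as the numerical order of binary expansions\<close>

lemma set_encode_less:
  assumes "finite A" "finite B" "A \<noteq> B" "Max ((A - B) \<union> (B - A)) \<in> B"
  shows "set_encode A < set_encode B"
proof -
  define M where "M = Max ((A - B) \<union> (B - A))"
  have "M \<in> (A - B) \<union> (B - A)"
    unfolding M_def using assms by (intro Max_in) auto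
  then have M: "M \<in> B" "M \<notin> A" using assms(4) by (auto simp: M_def)
  have above: "A \<inter> {M<..} = B \<inter> {M<..}"
  proof (intro set_eqI iffI)
    fix i assume "i \<in> A \<inter> {M<..}"
    then show "i \<in> B \<inter> {M<..}"
      using assms(1,2) Max_ge[of "(A - B) \<union> (B - A)" i] unfolding M_def by fastforce
  next
    fix i assume "i \<in> B \<inter> {M<..}"
    then show "i \<in> A \<inter> {M<..}"
      using assms(1,2) Max_ge[of "(A - B) \<union> (B - A)" i] unfolding M_def by fastforce
  qed
  have "i < M \<or> i > M" if "i \<in> A" for i
    using that M by (metis linorder_neqE_nat)
  then have "A \<subseteq> (A \<inter> {M<..}) \<union> {..<M}" by blast
  then have "set_encode A \<le> set_encode ((A \<inter> {M<..}) \<union> {..<M})"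
    unfolding set_encode_def using assms(1) by (intro sum_mono2) simp_all
  also have "\<dots> = (\<Sum>i\<in>A \<inter> {M<..}. 2 ^ i) + (\<Sum>i<M. 2 ^ i)"
    unfolding set_encode_def using assms by (intro sum.union_disjoint) auto
  \<comment> \<open>Above \<open>M\<close> the two sets agree, and all bits below \<open>M\<close>
    together give only 2^M - 1, which bit \<open>M\<close> of \<open>B\<close> outweighs.\<close>
  also have "\<dots> < (\<Sum>i\<in>B \<inter> {M<..}. 2 ^ i) + (\<Sum>i\<in>{M}. 2 ^ i)"
    by (simp add: above lessThan_atLeast0 sum_power2)
  also have "\<dots> = set_encode ((B \<inter> {M<..}) \<union> {M})"
    unfolding set_encode_def using assms by (intro sum.union_disjoint[symmetric]) auto
  also have "\<dots> \<le> set_encode B"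
    unfolding set_encode_def using M assms by (intro sum_mono2) auto
  finally show ?thesis .
qed

text \<open>Binary positions start at 0 while the sets to be ordered consist of positive integers;
  the shift by \<open>Suc\<close> preserves the order.\<close>

lemma colex_less_Suc_image:
  assumes "finite A" "finite B"
  shows "colex_less (Suc ` A) (Suc ` B) \<longleftrightarrow> A \<noteq> B \<and> Max ((A - B) \<union> (B - A)) \<in> B"
proof (cases "A = B")
  case False
  have "(Suc ` A - Suc ` B) \<union> (Suc ` B - Suc ` A) = Suc ` ((A - B) \<union> (B - A))" by auto
  moreover have "Suc (Max ((A - B) \<union> (B - A))) = Max (Suc ` ((A - B) \<union> (B - A)))"
    using assms False by (intro mono_Max_commute) (auto intro: monoI)
  ultimately have Max_eq: "Max ((Suc ` A - Suc ` B) \<union> (Suc ` B - Suc ` A))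
      = Suc (Max ((A - B) \<union> (B - A)))" by simp
  show ?thesis
    unfolding colex_less_def Max_eq by (simp add: inj_image_eq_iff inj_image_mem_iff)
qed (simp add: colex_less_def)

lemma colex_less_decode:
  "colex_less (Suc ` set_decode a) (Suc ` set_decode b) \<longleftrightarrow> a < b"
proof -
  let ?L = "\<lambda>a b. set_decode a \<noteq> set_decode b \<and>
    Max ((set_decode a - set_decode b) \<union> (set_decode b - set_decode a)) \<in> set_decode b"
  have L: "a < b" if "?L a b" for a b
    using set_encode_less[of "set_decode a" "set_decode b"] that by simp
  have "?L a b" if "a < b"
  proof -
    let ?D = "(set_decode a - set_decode b) \<union> (set_decode b - set_decode a)"
    have ne: "set_decode a \<noteq> set_decode b" using that by (metis nat_neq_iff set_decode_inverse)
    then have "Max ?D \<in> ?D" by (intro Max_in) auto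
    \<comment> \<open>If the largest difference lay in \<open>set_decode a\<close>, the direction
      already proved would give \<open>b < a\<close>.\<close>
    moreover have "Max ?D \<notin> set_decode a" if "Max ?D \<notin> set_decode b"
      using L[of b a] ne \<open>a < b\<close> by (metis Un_commute not_less_iff_gr_or_eq)
    ultimately show ?thesis using ne by blast
  qed
  with L[of a b] have "?L a b \<longleftrightarrow> a < b" by blast
  then show ?thesis by (simp only: colex_less_Suc_image finite_set_decode)
qed

lemma finite_pos_sets_eq: "finite_pos_sets = range (\<lambda>k. Suc ` set_decode k)"
proof (intro equalityI subsetI)
  fix A assume "A \<in> finite_pos_sets"
  then have A: "finite A" "0 \<notin> A" by (auto simp: finite_pos_sets_def)
  have "Suc (i - 1) = i" if "i \<in> A" for i
    using that A by (cases i) auto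
  then have "Suc ` (\<lambda>i. i - 1) ` A = A"
    by (simp add: image_image)
  then have "A = Suc ` set_decode (set_encode ((\<lambda>i. i - 1) ` A))"
    using A by simp
  then show "A \<in> range (\<lambda>k. Suc ` set_decode k)" by blast
qed (auto simp: finite_pos_sets_def)

lemma inj_Suc_image_decode: "inj (\<lambda>k. Suc ` set_decode k)"
  by (rule injI) (metis inj_Suc inj_image_eq_iff set_decode_inverse)

text \<open>The order isomorphism with the naturals gives the set of index \<open>k\<close> exactly
  the \<open>k\<close> predecessors of smaller index.\<close>

lemma colex_initial_eq: "colex_initial m = (\<lambda>k. Suc ` set_decode k) ` {..<m}"
proof -
  have "{B \<in> finite_pos_sets. colex_less B (Suc ` set_decode k)}
      = (\<lambda>k. Suc ` set_decode k) ` {..<k}" for k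
    by (auto simp: finite_pos_sets_eq colex_less_decode)
  then have "card {B \<in> finite_pos_sets. colex_less B (Suc ` set_decode k)} = k" for k
    by (simp add: card_image inj_on_subset[OF inj_Suc_image_decode])
  then show ?thesis
    by (auto simp: colex_initial_def finite_pos_sets_eq)
qed

lemma total_size_colex_initial: "total_size (colex_initial m) = binary_weight m"
  unfolding colex_initial_eq total_size_def binary_weight_def
  by (subst sum.reindex[OF inj_on_subset[OF inj_Suc_image_decode]]) (simp_all add: card_image)

section \<open>Down-compression\<close>

text \<open>The usual down-shift: a set containing \<open>x\<close> loses it unless the smaller set
  is already present. The link contributes both the moved sets and those that were there
  before.\<close>

definition compress :: "'a \<Rightarrow> 'a set set \<Rightarrow> 'a set set" where
  "compress x F = {A \<in> F. A - {x} \<in> F} \<union> link x F"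

definition newly :: "'a \<Rightarrow> 'a set set \<Rightarrow> 'a set set" where
  "newly x F = link x F - F"

abbreviation compress_list :: "'a list \<Rightarrow> 'a set set \<Rightarrow> 'a set set" where
  "compress_list \<equiv> fold compress"

lemma compress_mono: "F \<subseteq> G \<Longrightarrow> compress x F \<subseteq> compress x G"
  by (auto simp: compress_def link_def)

lemma compress_down_at: "down_at x F \<Longrightarrow> compress x F = F"
  by (force simp: compress_def link_def down_at_def)

lemma down_at_compress_same: "down_at x (compress x F)"
  by (auto simp: compress_def link_def down_at_def insert_absorb)

lemma down_at_compress:
  assumes "down_at y F"
  shows "down_at y (compress x F)"
proof (cases "x = y")
  case False
  show ?thesis unfolding down_at_def
  proof
    fix A assume A: "A \<in> compress x F"
    have "A - {y} - {x} = A - {x} - {y}" "insert x (A - {y}) = insert x A - {y}"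
      using False by auto
    with A assms show "A - {y} \<in> compress x F"
      by (auto simp: compress_def link_def down_at_def)
  qed
qed (simp add: down_at_compress_same)

text \<open>Compression is monotone and fixes families closed at \<open>x\<close>. Applied to power
  sets and to intervals, this shows which subfamilies survive later steps.\<close>

lemma compress_persists:
  assumes "Z \<subseteq> F" "down_at x Z"
  shows "Z \<subseteq> compress x F"
  using compress_mono[OF assms(1), of x] compress_down_at[OF assms(2)] by simp

lemma compress_subset_Pow: "F \<subseteq> Pow V \<Longrightarrow> compress x F \<subseteq> Pow V"
  by (auto simp: compress_def link_def)

text \<open>Unmoved sets and moved sets, before and after the step. The moved ones biject with
  \<open>newly x F\<close> and lose one point each, so cardinality is kept and the total size drops
  by the number of created sets.\<close>

lemma compress_split:
  "F = {A \<in> F. A - {x} \<in> F} \<union> insert x ` newly x F"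
  "{A \<in> F. A - {x} \<in> F} \<inter> insert x ` newly x F = {}"
  "compress x F = {A \<in> F. A - {x} \<in> F} \<union> newly x F"
  "{A \<in> F. A - {x} \<in> F} \<inter> newly x F = {}"
proof -
  show "F = {A \<in> F. A - {x} \<in> F} \<union> insert x ` newly x F"
  proof (intro equalityI subsetI)
    fix A assume "A \<in> F"
    then show "A \<in> {A \<in> F. A - {x} \<in> F} \<union> insert x ` newly x F"
      by (cases "x \<in> A")
        (auto simp: newly_def link_def insert_absorb intro!: image_eqI[of _ _ "A - {x}"])
  qed (auto simp: newly_def link_def)
qed (auto simp: newly_def link_def compress_def)

lemma finite_newly: "finite F \<Longrightarrow> finite (newly x F)"
  by (simp add: newly_def)

lemma inj_on_insert_newly: "inj_on (insert x) (newly x F)"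
  by (rule inj_on_insert_notin) (auto simp: newly_def link_def)

lemma card_compress: "finite F \<Longrightarrow> card (compress x F) = card F"
  by (subst (2) compress_split(1)[of F x])
    (simp add: compress_split(2-4) card_Un_disjoint card_image finite_newly inj_on_insert_newly)

lemma total_size_compress:
  assumes "finite F" "\<And>A. A \<in> F \<Longrightarrow> finite A"
  shows "total_size F = total_size (compress x F) + card (newly x F)"
proof -
  have "total_size F = total_size {A \<in> F. A - {x} \<in> F} + total_size (insert x ` newly x F)"
    unfolding total_size_def
    by (subst (1) compress_split(1)[of F x])
      (simp add: sum.union_disjoint compress_split(2) assms finite_newly)
  also have "total_size (insert x ` newly x F) = total_size (newly x F) + card (newly x F)"
  proof (rule total_size_insert_image)
    show "finite A \<and> x \<notin> A" if "A \<in> newly x F" for A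
      using that assms(2)[of "insert x A"] by (auto simp: newly_def link_def)
  qed (simp add: assms finite_newly)
  also have "total_size {A \<in> F. A - {x} \<in> F} + (total_size (newly x F) + card (newly x F))
      = total_size (compress x F) + card (newly x F)"
    unfolding total_size_def compress_split(3)
    by (simp add: sum.union_disjoint compress_split(4) assms finite_newly)
  finally show ?thesis .
qed

section \<open>Compression along a list of points\<close>

lemma compress_list_mono: "F \<subseteq> G \<Longrightarrow> compress_list xs F \<subseteq> compress_list xs G"
  by (induction xs arbitrary: F G) (simp_all add: compress_mono)

lemma compress_list_persists:
  assumes "Z \<subseteq> F" "\<And>x. x \<in> set xs \<Longrightarrow> down_at x Z"
  shows "Z \<subseteq> compress_list xs F"
  using assms by (induction xs arbitrary: F) (simp_all add: compress_persists)

lemma compress_list_subset_Pow: "F \<subseteq> Pow V \<Longrightarrow> compress_list xs F \<subseteq> Pow V"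
  by (induction xs arbitrary: F) (simp_all add: compress_subset_Pow)

lemma card_compress_list:
  assumes "F \<subseteq> Pow V" "finite V"
  shows "card (compress_list xs F) = card F"
  using assms(1)
proof (induction xs arbitrary: F)
  case (Cons x xs)
  then show ?case
    using card_compress[of F x] finite_subset[OF Cons.prems] assms(2)
    by (simp add: compress_subset_Pow)
qed simp

lemma down_at_compress_list: "down_at y F \<Longrightarrow> down_at y (compress_list xs F)"
  by (induction xs arbitrary: F) (simp_all add: down_at_compress)

lemma down_at_compress_list_member: "y \<in> set xs \<Longrightarrow> down_at y (compress_list xs F)"
  by (induction xs arbitrary: F) (auto simp: down_at_compress_list down_at_compress_same)

lemma down_at_Pow: "down_at x (Pow A)"
  by (auto simp: down_at_def)

lemma down_at_interval: "x \<noteq> y \<Longrightarrow> down_at x {{y}..A}"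
  by (auto simp: down_at_def)

lemma Pow_subset_compress:
  assumes "{{x}..insert x A} \<subseteq> F" "x \<notin> A"
  shows "Pow A \<subseteq> compress x F"
proof
  fix C assume "C \<in> Pow A"
  then have C: "insert x C \<in> {{x}..insert x A}" "x \<notin> C" using assms(2) by auto
  with assms(1) have "insert x C \<in> F" by blast
  with C show "C \<in> compress x F" by (simp add: compress_def link_def)
qed

text \<open>Steps at points other than \<open>x\<close> leave the interval in place, the step at
  \<open>x\<close> completes it to the whole power set of \<open>A\<close>, and a power set is fixed
  from then on.\<close>

lemma Pow_subset_compress_list:
  assumes "{{x}..insert x A} \<subseteq> F" "x \<notin> A" "x \<in> set xs"
  shows "Pow A \<subseteq> compress_list xs F"
  using assms(1,3)
proof (induction xs arbitrary: F)
  case (Cons y xs)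
  show ?case
  proof (cases "x = y")
    case True
    have "Pow A \<subseteq> compress y F"
      using Cons.prems(1) assms(2) unfolding True by (rule Pow_subset_compress)
    then show ?thesis
      unfolding fold_simps by (intro compress_list_persists down_at_Pow)
  next
    case False
    then have "{{x}..insert x A} \<subseteq> compress y F"
      by (intro compress_persists down_at_interval Cons.prems(1)) simp
    moreover have "x \<in> set xs" using False Cons.prems(2) by simp
    ultimately show ?thesis unfolding fold_simps by (rule Cons.IH)
  qed
qed simp

section \<open>Compressing a simply rooted family\<close>

text \<open>Invariant of the compression, where \<open>B\<close> is the original family and \<open>F\<close> the current one: it
  forces every set created at \<open>x\<close> to come from a set rooted at \<open>x\<close> in \<open>B\<close> itself.\<close>

definition free_or_rooted :: "'a set set \<Rightarrow> 'a set set \<Rightarrow> bool" where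
  "free_or_rooted B F \<longleftrightarrow> (\<forall>A\<in>F. Pow A \<subseteq> F \<or> (\<exists>r\<in>A. {{r}..A} \<subseteq> B \<inter> F))"

text \<open>As \<open>A\<close> is missing from \<open>F\<close>, the set \<open>insert x A\<close>
  is not free, and an interval from a root other than \<open>x\<close> would contain
  \<open>A\<close>. Hence its root is \<open>x\<close>.\<close>

lemma newly_rooted:
  assumes "free_or_rooted B F" "A \<in> newly x F"
  shows "{{x}..insert x A} \<subseteq> B \<inter> F"
proof -
  have A: "x \<notin> A" "A \<notin> F" "insert x A \<in> F" using assms(2) by (auto simp: newly_def link_def)
  then obtain r where r: "r \<in> insert x A" "{{r}..insert x A} \<subseteq> B \<inter> F"
    using assms(1) unfolding free_or_rooted_def by blast
  have "r = x"
  proof (rule ccontr)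
    assume "r \<noteq> x"
    then have "A \<in> {{r}..insert x A}" using r by auto
    then show False using r A by blast
  qed
  then show ?thesis using r by simp
qed

lemma free_or_rooted_compress:
  assumes inv: "free_or_rooted B F"
  shows "free_or_rooted B (compress x F)"
  unfolding free_or_rooted_def
proof
  fix A assume "A \<in> compress x F"
  then consider (new) "A \<in> newly x F" | (old) "A \<in> F" "A - {x} \<in> F"
    by (subst (asm) compress_split(3)) auto
  then show "Pow A \<subseteq> compress x F \<or> (\<exists>r\<in>A. {{r}..A} \<subseteq> B \<inter> compress x F)"
  proof cases
    case new
    then have "Pow A \<subseteq> compress x F"
      using newly_rooted[OF inv new] by (intro Pow_subset_compress) (auto simp: newly_def link_def)
    then show ?thesis ..
  next
    case old
    have keep: "{{r}..A} \<subseteq> B \<inter> compress x F" if "{{r}..A} \<subseteq> B \<inter> F" "r \<noteq> x" for r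
      using that compress_persists[of "{{r}..A}" F x] by (auto simp: down_at_interval)
    from old inv consider (free) "Pow A \<subseteq> F"
      | (rooted) r where "r \<in> A" "{{r}..A} \<subseteq> B \<inter> F" "r \<noteq> x"
      | (root) "x \<in> A" "{{x}..A} \<subseteq> B \<inter> F"
      unfolding free_or_rooted_def by blast
    then show ?thesis
    proof cases
      case free
      then show ?thesis by (intro disjI1 compress_persists down_at_Pow)
    next
      case rooted
      then show ?thesis using keep[of r] by blast
    next
      \<comment> \<open>A root at \<open>x\<close> may be destroyed by the step, so another reason
        is needed. It comes from \<open>A - {x}\<close>, which is also in \<open>F\<close>: if that
        set is free then so is \<open>A\<close>, and if it is rooted at \<open>w\<close> then so is
        \<open>A\<close>, the interval above \<open>{x}\<close> supplying the sets that contain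
        \<open>x\<close>.\<close>
      case root
      have with_x: "C \<in> B \<inter> F" if "C \<subseteq> A" "x \<in> C" for C
        using root that by auto
      from old inv consider (free') "Pow (A - {x}) \<subseteq> F"
        | (rooted') w where "w \<in> A - {x}" "{{w}..A - {x}} \<subseteq> B \<inter> F"
        unfolding free_or_rooted_def by blast
      then show ?thesis
      proof cases
        case free'
        have "Pow A \<subseteq> F"
        proof
          fix C assume "C \<in> Pow A"
          then show "C \<in> F" using free' with_x[of C] by (cases "x \<in> C") blast+
        qed
        then show ?thesis by (intro disjI1 compress_persists down_at_Pow)
      next
        case rooted'
        have "{{w}..A} \<subseteq> B \<inter> F"
        proof
          fix C assume C: "C \<in> {{w}..A}"
          show "C \<in> B \<inter> F"
          proof (cases "x \<in> C")
            case True
            then show ?thesis using C with_x by auto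
          next
            case False
            then have "C \<in> {{w}..A - {x}}" using C by auto
            then show ?thesis using rooted' by blast
          qed
        qed
        moreover have "w \<noteq> x" "w \<in> A" using rooted' by auto
        ultimately show ?thesis using keep[of w] by blast
      qed
    qed
  qed
qed

lemma free_or_rooted_compress_list:
  "free_or_rooted B F \<Longrightarrow> free_or_rooted B (compress_list xs F)"
  by (induction xs arbitrary: F) (simp_all add: free_or_rooted_compress)

text \<open>Sets created by compression stay free, so no set is created twice.\<close>

lemma total_size_compress_list_aux:
  assumes "finite V" "finite W" "F \<subseteq> Pow V" "free_or_rooted B F"
    and "Z \<subseteq> F" "\<And>x. x \<in> set xs \<Longrightarrow> down_at x Z"
    and "\<And>x A. x \<in> set xs \<Longrightarrow> x \<notin> A \<Longrightarrow> {{x}..insert x A} \<subseteq> B \<Longrightarrow> A \<in> W"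
  shows "total_size F \<le> total_size (compress_list xs F) + card ((W - Z) - {A. Pow A \<subseteq> F})"
  using assms(3-7)
proof (induction xs arbitrary: F)
  case (Cons x xs)
  let ?G = "compress x F"
  have finF: "finite F" "\<And>A. A \<in> F \<Longrightarrow> finite A"
    using Cons.prems(1) assms(1) by (auto intro: finite_subset)
  have "total_size ?G \<le> total_size (compress_list xs ?G) + card ((W - Z) - {A. Pow A \<subseteq> ?G})"
  proof (rule Cons.IH)
    show "A \<in> W" if "y \<in> set xs" "y \<notin> A" "{{y}..insert y A} \<subseteq> B" for y A
      using Cons.prems(5)[of y A] that by simp
  qed (use Cons.prems in \<open>simp_all add: compress_subset_Pow free_or_rooted_compress
    compress_persists\<close>)
  moreover have "card ((W - Z) - {A. Pow A \<subseteq> ?G}) + card (newly x F)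
      \<le> card ((W - Z) - {A. Pow A \<subseteq> F})"
  proof -
    \<comment> \<open>A created set is absent, hence not free, before the step and free after it. It
      therefore leaves the set of candidates counted by the bound, which pays for the point
      lost.\<close>
    have new: "A \<in> W" "A \<notin> Z" "Pow A \<subseteq> ?G" "\<not> Pow A \<subseteq> F" if "A \<in> newly x F" for A
    proof -
      have A: "x \<notin> A" "A \<notin> F" using that by (auto simp: newly_def link_def)
      have root: "{{x}..insert x A} \<subseteq> B \<inter> F" using newly_rooted[OF Cons.prems(2) that] .
      show "A \<in> W" using Cons.prems(5)[of x A] root A by simp
      show "A \<notin> Z" using A Cons.prems(3) by blast
      show "Pow A \<subseteq> ?G" using root A by (intro Pow_subset_compress) auto
      show "\<not> Pow A \<subseteq> F" using A by blast
    qed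
    have "card ((W - Z) - {A. Pow A \<subseteq> ?G}) + card (newly x F)
        = card (((W - Z) - {A. Pow A \<subseteq> ?G}) \<union> newly x F)"
      using assms(2) finF new(3)
      by (intro card_Un_disjoint[symmetric]) (simp_all add: finite_newly, blast)
    also have "\<dots> \<le> card ((W - Z) - {A. Pow A \<subseteq> F})"
    proof (intro card_mono subsetI)
      fix A assume "A \<in> ((W - Z) - {A. Pow A \<subseteq> ?G}) \<union> newly x F"
      then show "A \<in> (W - Z) - {A. Pow A \<subseteq> F}"
        using new[of A] compress_persists[OF _ down_at_Pow, of A F x] by auto
    qed (simp add: assms(2))
    finally show ?thesis .
  qed
  ultimately show ?case using total_size_compress[OF finF, of x] by simp
qed simp

text \<open>\<open>W\<close> holds every set that could be created and \<open>Z\<close> is a family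
  that stays put throughout. Created sets are distinct members of \<open>W - Z\<close>, and each
  accounts for one lost point.\<close>

lemma total_size_compress_list:
  assumes "finite V" "finite W" "F \<subseteq> Pow V" "free_or_rooted B F"
    and "Z \<subseteq> F" "\<And>x. x \<in> set xs \<Longrightarrow> down_at x Z"
    and "\<And>x A. x \<in> set xs \<Longrightarrow> x \<notin> A \<Longrightarrow> {{x}..insert x A} \<subseteq> B \<Longrightarrow> A \<in> W"
  shows "total_size F \<le> total_size (compress_list xs F) + card (W - Z)"
proof -
  have "card ((W - Z) - {A. Pow A \<subseteq> F}) \<le> card (W - Z)"
    using assms(2) by (intro card_mono) auto
  moreover have "total_size F
      \<le> total_size (compress_list xs F) + card ((W - Z) - {A. Pow A \<subseteq> F})"
    using assms by (rule total_size_compress_list_aux)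
  ultimately show ?thesis by simp
qed

section \<open>Families rooted in complementary sets\<close>

text \<open>The empty set has no root, and is counted on both sides.\<close>

definition rooted_or_empty :: "nat set set \<Rightarrow> nat set \<Rightarrow> nat set set" where
  "rooted_or_empty B S = rooted_part B S \<union> (B \<inter> {{}})"

lemma rooted_or_empty_subset: "rooted_or_empty B S \<subseteq> B"
  by (auto simp: rooted_or_empty_def rooted_part_def)

lemma rooted_at_subset:
  assumes "rooted_at B i A" "C \<subseteq> A" "i \<in> C"
  shows "rooted_at B i C"
proof -
  have "{{i}..C} \<subseteq> {{i}..A}" using assms(2) by auto
  with assms show ?thesis unfolding rooted_at_def by blast
qed

lemma interval_subset_rooted_or_empty:
  assumes "{{x}..insert x A} \<subseteq> B" "x \<in> S"
  shows "{{x}..insert x A} \<subseteq> rooted_or_empty B S"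
proof
  fix C assume C: "C \<in> {{x}..insert x A}"
  have "rooted_at B x (insert x A)" using assms(1) by (simp add: rooted_at_def)
  from rooted_at_subset[OF this, of C] C have "rooted_at B x C" by simp
  moreover have "C \<in> B" using C assms(1) by blast
  ultimately show "C \<in> rooted_or_empty B S"
    using assms(2) by (auto simp: rooted_or_empty_def rooted_part_def)
qed

text \<open>A nonempty member has a root in \<open>S\<close>, which differs from \<open>x\<close>
  and so remains a root after \<open>x\<close> is removed.\<close>

lemma down_at_rooted_or_empty:
  assumes "x \<notin> S"
  shows "down_at x (rooted_or_empty B S)"
  unfolding down_at_def
proof
  fix A assume A: "A \<in> rooted_or_empty B S"
  show "A - {x} \<in> rooted_or_empty B S"
  proof (cases "A = {}")
    case False
    then obtain i where i: "i \<in> S" "rooted_at B i A"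
      using A by (auto simp: rooted_or_empty_def rooted_part_def)
    then have "rooted_at B i (A - {x})"
      using assms by (intro rooted_at_subset[OF i(2)]) (auto simp: rooted_at_def)
    moreover from this have "A - {x} \<in> B" by (auto simp: rooted_at_def)
    ultimately show ?thesis using i by (auto simp: rooted_or_empty_def rooted_part_def)
  qed (use A in simp)
qed

lemma rooted_or_empty_cover:
  assumes "simply_rooted B" "B \<subseteq> Pow (S \<union> T)"
  shows "rooted_or_empty B S \<union> rooted_or_empty B T = B"
proof (intro equalityI subsetI)
  fix A assume A: "A \<in> B"
  show "A \<in> rooted_or_empty B S \<union> rooted_or_empty B T"
  proof (cases "A = {}")
    case False
    then obtain b where "b \<in> A" "rooted_at B b A"
      using assms(1) A by (auto simp: simply_rooted_def rooted_at_def)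
    then show ?thesis
      using A assms(2) by (force simp: rooted_or_empty_def rooted_part_def)
  qed (use A in \<open>simp add: rooted_or_empty_def\<close>)
qed (use rooted_or_empty_subset in blast)

lemma simply_rooted_free_or_rooted: "simply_rooted B \<Longrightarrow> free_or_rooted B B"
  unfolding simply_rooted_def free_or_rooted_def by auto

text \<open>The bound is multiplied by \<open>2 ^ card V\<close> so that the correlation inequality
  enters without division.\<close>

lemma total_size_simply_rooted:
  assumes "finite V" "B \<subseteq> Pow V" "simply_rooted B" "V = S \<union> T" "S \<inter> T = {}"
  shows "2 ^ card V * total_size B + card (rooted_or_empty B S) * card (rooted_or_empty B T)
    \<le> 2 ^ card V * (total_size (colex_initial (card B)) + card B)"
proof -
  let ?X = "rooted_or_empty B S" and ?Y = "rooted_or_empty B T"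
  have fin: "finite S" "finite T" using assms by auto
  obtain ss ts where sets: "set ss = S" "set ts = T" using fin finite_list by metis
  define B1 where "B1 = compress_list ss B"
  define B2 where "B2 = compress_list ts B1"
  define X' where "X' = compress_list ss ?X"
  define Y' where "Y' = compress_list ts ?Y"
  have XY: "?X \<subseteq> Pow V" "?Y \<subseteq> Pow V" using rooted_or_empty_subset assms(2) by blast+
  have Pow: "B1 \<subseteq> Pow V" "B2 \<subseteq> Pow V" "X' \<subseteq> Pow V" "Y' \<subseteq> Pow V"
    unfolding B1_def B2_def X'_def Y'_def
    by (intro compress_list_subset_Pow assms(2) XY)+
  have finP: "finite B1" "finite X'" "finite Y'" "finite B"
    using Pow assms(2) by (meson assms(1) finite_Pow_iff finite_subset)+
  have cards: "card B1 = card B" "card B2 = card B" "card X' = card ?X" "card Y' = card ?Y"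
    using card_compress_list[OF Pow(1) assms(1), of ts] card_compress_list[OF assms(2,1), of ss]
      card_compress_list[OF XY(1) assms(1), of ss] card_compress_list[OF XY(2) assms(1), of ts]
    by (simp_all add: B1_def B2_def X'_def Y'_def)
  have inv: "free_or_rooted B B" "free_or_rooted B B1"
    unfolding B1_def
    by (simp_all add: simply_rooted_free_or_rooted assms(3) free_or_rooted_compress_list)
  have Y_down: "down_at x ?Y" if "x \<in> set ss" for x
    using that sets assms(5) by (intro down_at_rooted_or_empty) auto
  \<comment> \<open>Closure at points of \<open>S\<close> is produced by the compression; at the
    other points it holds for \<open>?X\<close> already and is preserved.\<close>
  have X'_down: "down_at x X'" if "x \<in> V" for x
  proof (cases "x \<in> S")
    case True
    then show ?thesis unfolding X'_def by (intro down_at_compress_list_member) (simp add: sets)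
  next
    case False
    then show ?thesis
      unfolding X'_def by (intro down_at_compress_list down_at_rooted_or_empty)
  qed
  have Y'_down: "down_at x Y'" if "x \<in> V" for x
  proof (cases "x \<in> T")
    case True
    then show ?thesis unfolding Y'_def by (intro down_at_compress_list_member) (simp add: sets)
  next
    case False
    then show ?thesis
      unfolding Y'_def by (intro down_at_compress_list down_at_rooted_or_empty)
  qed
  have B2_down: "down_at x B2" if "x \<in> V" for x
  proof (cases "x \<in> T")
    case True
    then show ?thesis unfolding B2_def by (intro down_at_compress_list_member) (simp add: sets)
  next
    case False
    then have "x \<in> set ss" using that assms(4) sets by simp
    then show ?thesis
      unfolding B2_def B1_def by (intro down_at_compress_list down_at_compress_list_member)
  qed

  \<comment> \<open>First stage with \<open>W = B1\<close> and \<open>Z = ?Y\<close>: every set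
    created ends up in \<open>B1\<close>, and \<open>?Y\<close> is closed at the points of
    \<open>S\<close>.\<close>
  have "total_size B \<le> total_size B1 + card (B1 - ?Y)"
    unfolding B1_def
  proof (rule total_size_compress_list[OF assms(1) _ assms(2) inv(1)])
    show "A \<in> compress_list ss B" if "x \<in> set ss" "x \<notin> A" "{{x}..insert x A} \<subseteq> B" for x A
      using Pow_subset_compress_list[OF that(3,2,1)] by blast
  qed (use finP Y_down rooted_or_empty_subset in \<open>simp_all add: B1_def\<close>)
  \<comment> \<open>Second stage with \<open>W = Y'\<close> and \<open>Z = X'\<close>. By the
    invariant, a set created now still comes from a set rooted in the original \<open>B\<close> at a
    point of \<open>T\<close>; that interval lies in \<open>?Y\<close>, so the created set lies in
    \<open>Y'\<close>.\<close>
  moreover have "total_size B1 \<le> total_size B2 + card (Y' - X')"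
    unfolding B2_def
  proof (rule total_size_compress_list[OF assms(1) finP(3) Pow(1) inv(2)])
    show "X' \<subseteq> B1" unfolding X'_def B1_def
      by (rule compress_list_mono[OF rooted_or_empty_subset])
    show "down_at x X'" if "x \<in> set ts" for x using that X'_down sets assms(4) by blast
    show "A \<in> Y'" if "x \<in> set ts" "x \<notin> A" "{{x}..insert x A} \<subseteq> B" for x A
    proof -
      have "{{x}..insert x A} \<subseteq> ?Y"
        using that sets by (intro interval_subset_rooted_or_empty) auto
      from Pow_subset_compress_list[OF this that(2,1)] show ?thesis
        unfolding Y'_def by blast
    qed
  qed
  moreover have "total_size B2 \<le> total_size (colex_initial (card B))"
    using total_size_down_closed_le[OF assms(1) Pow(2) down_closedI[OF Pow(2) assms(1) B2_down]]
    by (simp add: cards total_size_colex_initial)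
  moreover have "card (B1 - ?Y) + card ?Y = card B"
  proof -
    have "?Y \<subseteq> B1"
      unfolding B1_def by (intro compress_list_persists Y_down rooted_or_empty_subset)
    then have "B1 \<inter> ?Y = ?Y" by blast
    then show ?thesis using finP(1) cards(1) card_Int_Diff[of B1 ?Y] by simp
  qed
  moreover have "card (Y' - X') + card (X' \<inter> Y') = card ?Y"
    using finP cards(4) card_Int_Diff[of Y' X'] by (simp add: Int_commute)
  ultimately have "total_size B + card (X' \<inter> Y') \<le> total_size (colex_initial (card B)) + card B"
    by linarith
  then have "2 ^ card V * (total_size B + card (X' \<inter> Y'))
      \<le> 2 ^ card V * (total_size (colex_initial (card B)) + card B)" by simp
  moreover have "card X' * card Y' \<le> 2 ^ card V * card (X' \<inter> Y')"
    by (intro card_down_closed_Int assms(1) Pow down_closedI[OF Pow(3) assms(1)]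
        down_closedI[OF Pow(4) assms(1)] X'_down Y'_down)
  ultimately show ?thesis
    unfolding cards distrib_left by linarith
qed

text \<open>A discrete intermediate value argument: adding one point to \<open>S\<close> enlarges
  the rooted family by less than pm sets, so its size cannot jump over the window from (1 - p)m/2 to
  (1 + p)m/2, whose width is pm.\<close>

lemma balanced_rooted_split:
  assumes "finite V" "B \<subseteq> Pow V" "simply_rooted B" "0 \<le> p" "p \<le> 1"
    and small: "\<And>i. i \<in> V \<Longrightarrow> real (card (rooted_part B {i})) < p * real (card B)"
  shows "\<exists>S\<subseteq>V. (real (card B))\<^sup>2 * (1 - p\<^sup>2) / 4
    \<le> real (card (rooted_or_empty B S)) * real (card (rooted_or_empty B (V - S)))"
proof -
  let ?m = "real (card B)" and ?X = "rooted_or_empty B"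
  let ?t = "(1 - p) * ?m / 2"
  have finB: "finite B" using assms by (auto intro: finite_subset)
  have finX: "finite (?X S)" for S using rooted_or_empty_subset finB by (rule finite_subset)
  have cover: "?m \<le> real (card (?X S)) + real (card (?X (V - S)))" if "S \<subseteq> V" for S
  proof -
    have "B = ?X S \<union> ?X (V - S)"
      using rooted_or_empty_cover[OF assms(3), of S "V - S"] that assms(2) by (simp add: Un_absorb1)
    then have "card B \<le> card (?X S) + card (?X (V - S))" by (metis card_Un_le)
    then show ?thesis by linarith
  qed
  show ?thesis
  \<comment> \<open>The family for the empty \<open>S\<close> contains at most the empty set, so it
    reaches the threshold only when \<open>?t\<close> is at most 1. Then \<open>S = {}\<close>
    itself works, its partner being all of \<open>B\<close>.\<close>
  proof (cases "?t \<le> real (card (?X {}))")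
    case True
    have XV: "?X V = B"
      using rooted_or_empty_cover[OF assms(3), of V V] assms(2) by simp
    have "?m\<^sup>2 * (1 - p\<^sup>2) / 4 = ?t * ?m * ((1 + p) / 2)"
      by (simp add: power2_eq_square field_simps)
    also have "\<dots> \<le> ?t * ?m * 1"
      using assms(4,5) by (intro mult_left_mono) auto
    also have "\<dots> \<le> real (card (?X {})) * ?m"
      unfolding mult_1_right using True by (rule mult_right_mono) simp
    finally show ?thesis by (intro exI[of _ "{}"]) (simp add: XV)
  next
    case False
    have "\<exists>S\<subseteq>V. \<exists>i\<in>V. real (card (?X S)) < ?t \<and> ?t \<le> real (card (?X (insert i S)))"
    proof (rule ccontr)
      assume none: "\<not> ?thesis"
      have "real (card (?X S)) < ?t" if "finite S" "S \<subseteq> V" for S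
        using that
      proof (induction S)
        case empty
        then show ?case using False by simp
      next
        case (insert i S)
        then have "real (card (?X S)) < ?t" "S \<subseteq> V" "i \<in> V" by auto
        with none have "\<not> ?t \<le> real (card (?X (insert i S)))" by blast
        then show ?case by simp
      qed
      then have "real (card (?X V)) < ?t" using assms(1) by blast
      moreover have "?X V = B" using rooted_or_empty_cover[OF assms(3), of V V] assms(2) by simp
      moreover have "?t \<le> ?m" using assms(4) by (simp add: algebra_simps)
      ultimately show False by simp
    qed
    then obtain S i where S: "S \<subseteq> V" "i \<in> V" "real (card (?X S)) < ?t"
      and ge: "?t \<le> real (card (?X (insert i S)))" by blast
    define a where "a = real (card (?X (insert i S)))"
    have "?X (insert i S) \<subseteq> ?X S \<union> rooted_part B {i}"
      by (auto simp: rooted_or_empty_def rooted_part_def)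
    then have "card (?X (insert i S)) \<le> card (?X S \<union> rooted_part B {i})"
      using finX finB by (intro card_mono) (auto simp: rooted_part_def)
    also have "\<dots> \<le> card (?X S) + card (rooted_part B {i})" by (rule card_Un_le)
    finally have "a < ?t + p * ?m" using S small[of i] by (simp add: a_def)
    then have le: "a \<le> (1 + p) * ?m / 2" by (simp add: field_simps)
    \<comment> \<open>The ends of the window have sum m and product m^2 (1 - p^2)/4, so the product
      of the distances from \<open>a\<close> to them is a(m - a) minus the target.\<close>
    have "0 \<le> (a - ?t) * ((1 + p) * ?m / 2 - a)"
      using le ge by (intro mult_nonneg_nonneg) (auto simp: a_def)
    moreover have "(a - ?t) * ((1 + p) * ?m / 2 - a) = a * (?m - a) - ?m\<^sup>2 * (1 - p\<^sup>2) / 4"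
      by (simp add: power2_eq_square field_simps)
    ultimately have "?m\<^sup>2 * (1 - p\<^sup>2) / 4 \<le> a * (?m - a)" by linarith
    also have "\<dots> \<le> a * real (card (?X (V - insert i S)))"
      using cover[of "insert i S"] S by (intro mult_left_mono) (auto simp: a_def)
    finally show ?thesis using S unfolding a_def by (intro exI[of _ "insert i S"]) simp
  qed
qed

theorem theorem34:
  fixes n m :: nat and \<B> :: "nat set set" and p :: real
  assumes "n > 0"
    and "\<B> \<subseteq> Pow {1..n}"
    and "simply_rooted \<B>"
    and "card \<B> = m"
    and "0 \<le> p" and "p \<le> 1"
    and "\<not> (\<exists>i\<in>{1..n}. real (card (rooted_part \<B> {i})) \<ge> p * real m)"
  shows "real (total_size \<B>) \<le> real (total_size (colex_initial m)) + real m
           - (real m)^2 * (1/8 - p^2/8) / 2^n"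
proof -
  obtain S where S: "S \<subseteq> {1..n}" and big: "(real m)\<^sup>2 * (1 - p\<^sup>2) / 4
      \<le> real (card (rooted_or_empty \<B> S)) * real (card (rooted_or_empty \<B> ({1..n} - S)))"
    using balanced_rooted_split[of "{1..n}" \<B> p] assms by (auto simp: not_le)
  let ?x = "card (rooted_or_empty \<B> S)" and ?y = "card (rooted_or_empty \<B> ({1..n} - S))"
  have "2 ^ n * total_size \<B> + ?x * ?y \<le> 2 ^ n * (total_size (colex_initial m) + m)"
    using total_size_simply_rooted[of "{1..n}" \<B> S "{1..n} - S"] S assms by auto
  then have "real (2 ^ n * total_size \<B> + ?x * ?y)
      \<le> real (2 ^ n * (total_size (colex_initial m) + m))" by (simp only: of_nat_le_iff)
  then have "2 ^ n * real (total_size \<B>) + real ?x * real ?y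
      \<le> 2 ^ n * (real (total_size (colex_initial m)) + real m)" by simp
  \<comment> \<open>The split yields the coefficient (1 - p^2)/4, twice the one claimed.\<close>
  moreover have "(real m)\<^sup>2 * (1/8 - p\<^sup>2/8) \<le> (real m)\<^sup>2 * (1 - p\<^sup>2) / 4"
  proof -
    have "0 \<le> (real m)\<^sup>2 * (1 - p\<^sup>2)" using assms(5,6) by (simp add: power_le_one)
    then show ?thesis by (simp add: algebra_simps)
  qed
  ultimately have "2 ^ n * real (total_size \<B>) + (real m)\<^sup>2 * (1/8 - p\<^sup>2/8)
      \<le> 2 ^ n * (real (total_size (colex_initial m)) + real m)" using big by linarith
  then show ?thesis by (simp add: field_simps)
qed

end
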